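(* Let $\mathcal F_{\Delta t}=\mathcal F^a_{\Delta t}\star\mathcal F^b_{\Delta t}$ or $\mathcal F_{\Delta t}=\mathcal F^a_{\Delta t/2}\star\mathcal F^b_{\Delta t}\star\mathcal F^a_{\Delta t/2}$. Then the full discretization $\widetilde{\mathcal F}_{\Delta t}:(Q^n,P^n,B^n,\Theta^n)\mapsto(Q^{n+1},P^{n+1},B^{n+1},\Theta^{n+1})$ of the stochastic cubic Schrödinger equation with multiplicative noise, obtained from $\mathcal F_{\Delta t}$ by symmetric projection, preserves the discrete charge conservation law, i.e. $$(P^{n+1})^\top P^{n+1}+(Q^{n+1})^\top Q^{n+1}=(P^{n})^\top P^{n}+(Q^{n})^\top Q^{n}\quad\text{a.s.}$$ for $n\in\{0,1,\ldots,N-1\}$.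
   Context: **Equation.** The stochastic cubic Schrödinger equation is $\mathbf i\,du+u_{xx}dt+|u|^2u\,dt=u\circ dW(t)$, $u(0)=u_0$, $t\in(0,T)$, on a bounded interval with homogeneous Dirichlet boundary condition, with $u=p+\mathbf i q$ and $W$ a $\mathbf Q$-Wiener process with (truncated) expansion $\sum_{k=1}^M\sqrt{\lambda_k}\,e_k\beta_k(t)$, $\beta_k$ independent Brownian motions. **Spatial discretization.** Let $L\ge2$ be an integer, $x_0<x_1<\dots<x_L$ a uniform grid of the interval with step $h$. Let $D^+,D^-\in\mathbb{R}^{(L-1)\times(L-1)}$: $D^+$ has diagonal entries $-1/h$, first superdiagonal entries $1/h$, and zeros elsewhere; $D^-$ has diagonal entries $1/h$, first subdiagonal entries $-1/h$, and zeros elsewhere. Let $\boldsymbol\Lambda=\mathrm{diag}(\sqrt{\lambda_1},\dots,\sqrt{\lambda_M})$, $\boldsymbol\beta=(\beta_1,\dots,\beta_M)^\top$, $\mathbf E=(e_k(x_i))_{1\le i\le L-1,\,1\le k\le M}$. With $P_i\approx p(x_i,\cdot)$, $Q_i\approx q(x_i,\cdot)$, $\Theta=D^-P$, $B=D^-Q$, the semi-discretization is $$dQ=D^+\Theta dt+(\mathrm{diag}(P)^2+\mathrm{diag}(Q)^2)P\,dt-\mathrm{diag}(P)\mathbf E\boldsymbol\Lambda\circ d\boldsymbol\beta,\quad dP=-D^+B\,dt-(\mathrm{diag}(P)^2+\mathrm{diag}(Q)^2)Q\,dt+\mathrm{diag}(Q)\mathbf E\boldsymbol\Lambda\circ d\boldsymbol\beta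 .$$ **Extended system.** On $(Q,X,P,Y)\in\mathbb{R}^{4(L-1)}$: $$\begin{aligned} dQ&=D^+D^-P\,dt+(\mathrm{diag}(P)^2+\mathrm{diag}(X)^2)P\,dt-\mathrm{diag}(P)\mathbf E\boldsymbol\Lambda\circ d\boldsymbol\beta,\\ dX&=D^+D^-Y\,dt+(\mathrm{diag}(Y)^2+\mathrm{diag}(Q)^2)Y\,dt-\mathrm{diag}(Y)\mathbf E\boldsymbol\Lambda\circ d\boldsymbol\beta,\\ dP&=-D^+D^-Q\,dt-(\mathrm{diag}(Q)^2+\mathrm{diag}(Y)^2)Q\,dt+\mathrm{diag}(Q)\mathbf E\boldsymbol\Lambda\circ d\boldsymbol\beta,\\ dY&=-D^+D^-X\,dt-(\mathrm{diag}(X)^2+\mathrm{diag}(P)^2)X\,dt+\mathrm{diag}(X)\mathbf E\boldsymbol\Lambda\circ d\boldsymbol\beta. \end{aligned}$$ $\mathcal F^a$ is the flow of the subsystem consisting of the $X$- and $P$-equations with $dQ=dY=0$; $\mathcal F^b$ is the flow of the subsystem consisting of the $Q$- and $Y$-equations with $dX=dP=0$. Over a subinterval of length $\tau$ with Brownian increment $\delta\boldsymbol\beta$ they are explicit: $\mathcal F^a$ keeps $Q,Y$ fixed and maps $$P\mapsto P-\tau\big(D^+D^-Q+(\mathrm{diag}(Q)^2+\mathrm{diag}(Y)^2)Q\big)+\mathrm{diag}(Q)\mathbf E\boldsymbol\Lambda\delta\boldsymbol\beta,\quad X\mapsto X+\tau\big(D^+D^-Y+(\mathrm{diag}(Q)^2+\mathrm{diag}(Y)^2)Y\big)-\mathrm{diag}(Y)\mathbf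 E\boldsymbol\Lambda\delta\boldsymbol\beta;$$ $\mathcal F^b$ keeps $P,X$ fixed and maps $$Q\mapsto Q+\tau\big(D^+D^-P+(\mathrm{diag}(P)^2+\mathrm{diag}(X)^2)P\big)-\mathrm{diag}(P)\mathbf E\boldsymbol\Lambda\delta\boldsymbol\beta,\quad Y\mapsto Y-\tau\big(D^+D^-X+(\mathrm{diag}(P)^2+\mathrm{diag}(X)^2)X\big)+\mathrm{diag}(X)\mathbf E\boldsymbol\Lambda\delta\boldsymbol\beta.$$ $\star$ denotes composition, leftmost factor applied first. On $[t_n,t_{n+1}]$ ($t_n=n\Delta t$, $\Delta t=T/N$), factors with subscript $\Delta t$ have $\tau=\Delta t$ and increment $\boldsymbol\beta(t_{n+1})-\boldsymbol\beta(t_n)$; in $\mathcal F^a_{\Delta t/2}\star\mathcal F^b_{\Delta t}\star\mathcal F^a_{\Delta t/2}$ the first factor has $\tau=\frac{\Delta t}2$ and increment $\boldsymbol\beta(t_n+\frac{\Delta t}2)-\boldsymbol\beta(t_n)$, and the last one $\tau=\frac{\Delta t}2$ and increment $\boldsymbol\beta(t_{n+1})-\boldsymbol\beta(t_n+\frac{\Delta t}2)$. **Full discretization (symmetric projection).** Let $A=\begin{bmatrix}I_{L-1}&-I_{L-1}&0&0\\0&0&I_{L-1}&-I_{L-1}\end{bmatrix}$, $\mathcal N=\ker A$. Given $(Q^n,P^n,B^n,\Theta^n)$ with $B^n=D^-Q^n$, $\Theta^n=D^-P^n$, set $Z^n=((Q^n)^\top,(Q^n)^\top,(P^n)^\top,(P^n)^\top)^\top\in\mathcal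 N$ and let $\lambda\in\mathbb{R}^{2(L-1)}$ be determined by requiring $$Z^{n+1}:=\mathcal F_{\Delta t}(Z^n+A^\top\lambda)+A^\top\lambda\in\mathcal N .$$ Then $Z^{n+1}=((Q^{n+1})^\top,(Q^{n+1})^\top,(P^{n+1})^\top,(P^{n+1})^\top)^\top$ defines $Q^{n+1},P^{n+1}$, and $B^{n+1}:=D^-Q^{n+1}$, $\Theta^{n+1}:=D^-P^{n+1}$. It is understood that $\Delta t$ is small enough that $\lambda$ exists as the local solution near $0$ given by the implicit function theorem. *)

theory Defs
  imports "HOL-Probability.Probability"
begin

text \<open>Synonyms for \<open>real ^ 'n\<close> and \<open>real ^ 'm ^ 'n\<close> (rows indexed by \<open>'n\<close>) that leave room for sort constraints.\<close>

type_synonym 'n rvec = "(real, 'n) vec"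
type_synonym ('n, 'm) rmat = "((real, 'm) vec, 'n) vec"

definition standard_Brownian_motion :: "'w measure \<Rightarrow> (real \<Rightarrow> 'w \<Rightarrow> real) \<Rightarrow> bool" where
  "standard_Brownian_motion M B \<longleftrightarrow>
     (\<forall>t\<ge>0. B t \<in> borel_measurable M) \<and>
     (AE \<omega> in M. B 0 \<omega> = 0) \<and>
     (\<forall>s t. 0 \<le> s \<and> s < t \<longrightarrow>
        distributed M lborel (\<lambda>\<omega>. B t \<omega> - B s \<omega>) (normal_density 0 (sqrt (t - s)))) \<and>
     (\<forall>(t :: nat \<Rightarrow> real) m. 0 \<le> t 0 \<and> mono t \<longrightarrow>
        prob_space.indep_vars M (\<lambda>_. borel) (\<lambda>i \<omega>. B (t (Suc i)) \<omega> - B (t i) \<omega>) {..<m}) \<and>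
     (AE \<omega> in M. continuous_on {0..} (\<lambda>t. B t \<omega>))"

text \<open>
  Data of the truncated expansion \<open>\<Sum>\<^sub>k sqrt (lam k) e k (x) beta k (t)\<close> of a Q-Wiener process on
  \<open>L\<^sup>2(a,b)\<close>: \<open>lam k\<close> and \<open>e k\<close> are eigenvalues and orthonormal eigenfunctions of the nonnegative
  operator Q, and the finite type \<open>'m\<close> is the index set \<open>{1..M}\<close> of the truncation. The Brownian
  motions are independent as processes, i.e. as random elements of the space of functions on
  \<open>[0,\<infinity>)\<close> with the product sigma-algebra.
\<close>

definition Q_Wiener_expansion ::
  "'w measure \<Rightarrow> real \<Rightarrow> real \<Rightarrow> ('m::finite \<Rightarrow> real) \<Rightarrow> ('m \<Rightarrow> real \<Rightarrow> real) \<Rightarrow>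
   ('m \<Rightarrow> real \<Rightarrow> 'w \<Rightarrow> real) \<Rightarrow> bool" where
  "Q_Wiener_expansion M a b lam e beta \<longleftrightarrow>
     (\<forall>k. 0 \<le> lam k) \<and>
     (\<forall>k. set_borel_measurable lborel {a..b} (e k)) \<and>
     (\<forall>j k. set_integrable lborel {a..b} (\<lambda>x. e j x * e k x) \<and>
            (LINT x:{a..b}|lborel. e j x * e k x) = (if j = k then 1 else 0)) \<and>
     (\<forall>k. standard_Brownian_motion M (beta k)) \<and>
     prob_space.indep_vars M (\<lambda>_. PiM {0..} (\<lambda>_. borel)) (\<lambda>k \<omega>. \<lambda>t\<in>{0..}. beta k t \<omega>) UNIV"

definition Brownian_vec :: "('m::finite \<Rightarrow> real \<Rightarrow> 'w \<Rightarrow> real) \<Rightarrow> real \<Rightarrow> 'w \<Rightarrow> 'm rvec" where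
  "Brownian_vec beta t \<omega> = (\<chi> k. beta k t \<omega>)"

text \<open>
  Interior grid points are indexed by a finite linearly ordered type \<open>'n\<close>; \<open>grid_index\<close> is its order
  isomorphism onto \<open>{1..CARD('n)}\<close>, with \<open>CARD('n) = L - 1\<close> in the intended use.
\<close>

definition grid_index :: "'n::{finite,linorder} \<Rightarrow> nat" where
  "grid_index i = card {..i}"

definition grid_point :: "real \<Rightarrow> real \<Rightarrow> 'n::{finite,linorder} \<Rightarrow> real" where
  "grid_point a h i = a + real (grid_index i) * h"

definition D_plus :: "real \<Rightarrow> ('n::{finite,linorder}, 'n) rmat" where
  "D_plus h = (\<chi> i j. if j = i then - 1 / h
                      else if grid_index j = grid_index i + 1 then 1 / h else 0)"

definition D_minus :: "real \<Rightarrow> ('n::{finite,linorder}, 'n) rmat" where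
  "D_minus h = (\<chi> i j. if j = i then 1 / h
                       else if grid_index i = grid_index j + 1 then - 1 / h else 0)"

definition diag :: "'n rvec \<Rightarrow> ('n::finite, 'n) rmat" where
  "diag v = (\<chi> i j. if i = j then v $ i else 0)"

definition noise_E :: "real \<Rightarrow> real \<Rightarrow> ('m \<Rightarrow> real \<Rightarrow> real) \<Rightarrow> ('n::{finite,linorder}, 'm::finite) rmat" where
  "noise_E a h e = (\<chi> i k. e k (grid_point a h i))"

definition noise_Lambda :: "('m \<Rightarrow> real) \<Rightarrow> ('m::finite, 'm) rmat" where
  "noise_Lambda lam = diag (\<chi> k. sqrt (lam k))"

text \<open>
  Extended states are quadruples \<open>(Q, X, P, Y)\<close>. In the flows, \<open>G\<close> is the noise matrix
  \<open>E ** Lambda\<close>, \<open>\<tau>\<close> the length of the subinterval and \<open>w\<close> the Brownian increment over it.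
\<close>

type_synonym 'n ext_state =
  "'n rvec \<times> 'n rvec \<times> 'n rvec \<times> 'n rvec"

definition flow_a :: "real \<Rightarrow> ('n::{finite,linorder}, 'm::finite) rmat \<Rightarrow> real \<Rightarrow> 'm rvec \<Rightarrow>
    'n ext_state \<Rightarrow> 'n ext_state" where
  "flow_a h G \<tau> w = (\<lambda>(Q, X, P, Y).
     (Q,
      X + \<tau> *\<^sub>R ((D_plus h ** D_minus h) *v Y + (diag Q ** diag Q + diag Y ** diag Y) *v Y)
        - (diag Y ** G) *v w,
      P - \<tau> *\<^sub>R ((D_plus h ** D_minus h) *v Q + (diag Q ** diag Q + diag Y ** diag Y) *v Q)
        + (diag Q ** G) *v w,
      Y))"

definition flow_b :: "real \<Rightarrow> ('n::{finite,linorder}, 'm::finite) rmat \<Rightarrow> real \<Rightarrow> 'm rvec \<Rightarrow>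
    'n ext_state \<Rightarrow> 'n ext_state" where
  "flow_b h G \<tau> w = (\<lambda>(Q, X, P, Y).
     (Q + \<tau> *\<^sub>R ((D_plus h ** D_minus h) *v P + (diag P ** diag P + diag X ** diag X) *v P)
        - (diag P ** G) *v w,
      X,
      P,
      Y - \<tau> *\<^sub>R ((D_plus h ** D_minus h) *v X + (diag P ** diag P + diag X ** diag X) *v X)
        + (diag X ** G) *v w))"

text \<open>
  The data of one time step are \<open>(\<tau>, w1, w2)\<close>: the step size and the Brownian increments over the
  first and the second half of the step, so that \<open>w1 + w2\<close> is the increment over the whole step.
  \<open>\<star>\<close> is the library's composition operator that applies the left factor first.
\<close>

notation fcomp (infixl "\<star>" 60)

type_synonym 'm step_data = "real \<times> 'm rvec \<times> 'm rvec"

definition step_data ::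
  "('m::finite \<Rightarrow> real \<Rightarrow> 'w \<Rightarrow> real) \<Rightarrow> real \<Rightarrow> nat \<Rightarrow> 'w \<Rightarrow> 'm step_data" where
  "step_data beta dt n \<omega> =
     (let t = real n * dt; t' = real (Suc n) * dt in
       (dt,
        Brownian_vec beta (t + dt / 2) \<omega> - Brownian_vec beta t \<omega>,
        Brownian_vec beta t' \<omega> - Brownian_vec beta (t + dt / 2) \<omega>))"

definition Lie_splitting :: "real \<Rightarrow> ('n::{finite,linorder}, 'm::finite) rmat \<Rightarrow> 'm step_data \<Rightarrow>
    'n ext_state \<Rightarrow> 'n ext_state" where
  "Lie_splitting h G = (\<lambda>(\<tau>, w1, w2). flow_a h G \<tau> (w1 + w2) \<star> flow_b h G \<tau> (w1 + w2))"

definition Strang_splitting :: "real \<Rightarrow> ('n::{finite,linorder}, 'm::finite) rmat \<Rightarrow> 'm step_data \<Rightarrow>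
    'n ext_state \<Rightarrow> 'n ext_state" where
  "Strang_splitting h G = (\<lambda>(\<tau>, w1, w2).
     flow_a h G (\<tau> / 2) w1 \<star> flow_b h G \<tau> (w1 + w2) \<star> flow_a h G (\<tau> / 2) w2)"

text \<open>The matrix \<open>[[I, -I, 0, 0], [0, 0, I, -I]]\<close>, written as the linear map it represents; its
  transpose is the library's \<open>adjoint\<close>, and \<open>{z. proj_A z = 0}\<close> is its kernel.\<close>

definition proj_A :: "'n::finite ext_state \<Rightarrow> 'n rvec \<times> 'n rvec" where
  "proj_A = (\<lambda>(Q, X, P, Y). (Q - X, P - Y))"

definition sym_proj :: "('u \<Rightarrow> 'n::finite ext_state \<Rightarrow> 'n ext_state) \<Rightarrow> 'u \<Rightarrow>
    'n ext_state \<Rightarrow> 'n rvec \<times> 'n rvec \<Rightarrow> 'n ext_state" where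
  "sym_proj F u Z l = F u (Z + adjoint proj_A l) + adjoint proj_A l"

text \<open>
  \<open>l\<close> is the value at \<open>u\<close> of the local solution \<open>g\<close> near \<open>0\<close> of \<open>C v (g v) = 0\<close> provided by the
  implicit function theorem at \<open>(0, 0)\<close>. Convexity of the neighbourhood \<open>U\<close> makes this value
  independent of the choice of \<open>U\<close>, \<open>V\<close> and \<open>g\<close>.
\<close>

definition implicit_local_solution ::
  "('u::real_normed_vector \<Rightarrow> 'v::real_normed_vector \<Rightarrow> 'c::real_normed_vector) \<Rightarrow> 'u \<Rightarrow> 'v \<Rightarrow> bool"
  where
  "implicit_local_solution C u l \<longleftrightarrow>
     (\<exists>U V g. open U \<and> convex U \<and> 0 \<in> U \<and> u \<in> U \<and> open V \<and> 0 \<in> V \<and>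
        continuous_on U g \<and> g ` U \<subseteq> V \<and> g 0 = 0 \<and> g u = l \<and>
        (\<forall>v\<in>U. \<forall>x\<in>V. C v x = 0 \<longleftrightarrow> x = g v))"

definition proj_multiplier :: "('u::real_normed_vector \<Rightarrow> 'n::finite ext_state \<Rightarrow> 'n ext_state) \<Rightarrow>
    'u \<Rightarrow> 'n ext_state \<Rightarrow> 'n rvec \<times> 'n rvec \<Rightarrow> bool" where
  "proj_multiplier F u Z l \<longleftrightarrow> implicit_local_solution (\<lambda>v x. proj_A (sym_proj F v Z x)) u l"

text \<open>The map \<open>(Q, P, B, \<Theta>) \<mapsto> (Q', P', B', \<Theta>')\<close>. It is meaningful where a multiplier
  exists, and then \<open>SOME\<close> picks the only one.\<close>

definition full_discretization :: "real \<Rightarrow>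
    ('u::real_normed_vector \<Rightarrow> 'n::{finite,linorder} ext_state \<Rightarrow> 'n ext_state) \<Rightarrow> 'u \<Rightarrow>
    'n rvec \<times> 'n rvec \<times> 'n rvec \<times> 'n rvec \<Rightarrow>
    'n rvec \<times> 'n rvec \<times> 'n rvec \<times> 'n rvec" where
  "full_discretization h F u = (\<lambda>(Q, P, B, \<Theta>).
     (let Z = (Q, Q, P, P);
          l = (SOME l. proj_multiplier F u Z l);
          (Q', X', P', Y') = sym_proj F u Z l
      in (Q', P', D_minus h *v Q', D_minus h *v P')))"

end

theory Submission
  imports Defs
begin

text \<open>
  Both partial flows, and hence both splittings, preserve the bilinear invariant
  \<open>Q \<bullet> X + P \<bullet> Y\<close> of the extended system: each moves \<open>(X, P)\<close> by \<open>(S Y, - S Q)\<close>, or \<open>(Q, Y)\<close> by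
  \<open>(S P, - S X)\<close>, with a symmetric matrix \<open>S\<close>. On the kernel of \<open>A\<close> this invariant is the charge, and
  adding or subtracting \<open>A\<^sup>T \<lambda>\<close> changes its value there by the same amount \<open>- \<lambda> \<bullet> \<lambda>\<close>, so the two
  perturbations of the symmetric projection cancel.
\<close>

lemma inner_diag_mult:
  fixes v x y :: "real ^ 'n::finite"
  shows "(diag v *v x) \<bullet> y = x \<bullet> (diag v *v y)"
  by (simp add: diag_def matrix_vector_mult_def inner_vec_def if_distrib if_distribR
      mult.assoc mult.left_commute cong: if_cong)

text \<open>Both sides are the componentwise product. This lets the state in the multiplicative
  noise trade places with the noise vector.\<close>

lemma diag_mult_commute:
  fixes v x :: "real ^ 'n::finite"
  shows "diag v *v x = diag x *v v"
  by (simp add: diag_def matrix_vector_mult_def vec_eq_iff if_distrib if_distribR mult.commute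
      cong: if_cong)

text \<open>Discrete integration by parts: the homogeneous Dirichlet values leave no boundary
  terms.\<close>

lemma D_plus_eq_uminus_transpose: "D_plus h = - transpose (D_minus h)"
  by (auto simp: D_plus_def D_minus_def transpose_def vec_eq_iff)

lemma inner_laplacian:
  fixes x y :: "'n::{finite,linorder} rvec"
  shows "((D_plus h ** D_minus h) *v x) \<bullet> y = x \<bullet> ((D_plus h ** D_minus h) *v y)"
proof -
  have "(- K) *v y = - (K *v y)" for K :: "('n, 'n) rmat" and y :: "'n rvec"
    by (simp add: matrix_vector_mult_def vec_eq_iff sum_negf)
  \<comment> \<open>The right-hand side is symmetric in \<open>u\<close> and \<open>v\<close>, so
    instantiating it in both orders gives the claim.\<close>
  then have "((D_plus h ** D_minus h) *v u) \<bullet> v = - ((D_minus h *v u) \<bullet> (D_minus h *v v))"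
    for u v :: "'n rvec"
    by (simp add: D_plus_eq_uminus_transpose matrix_vector_mul_assoc [symmetric] dot_lmul_matrix)
  from this [of x y] this [of y x] show ?thesis
    by (simp add: inner_commute)
qed

text \<open>\<open>U\<close> and \<open>V\<close> stand for the two components that a partial flow
  keeps fixed. Only their squares enter as coefficients, so the cubic term becomes linear in
  \<open>x\<close>, and one operator serves both moving components.\<close>

definition step_operator :: "real \<Rightarrow> ('n::{finite,linorder}, 'm::finite) rmat \<Rightarrow> real \<Rightarrow> 'm rvec \<Rightarrow>
    'n rvec \<Rightarrow> 'n rvec \<Rightarrow> 'n rvec \<Rightarrow> 'n rvec" where
  "step_operator h G \<tau> w U V x =
     \<tau> *\<^sub>R ((D_plus h ** D_minus h) *v x + (diag U ** diag U + diag V ** diag V) *v x)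
       - (diag x ** G) *v w"

lemma inner_step_operator:
  fixes x y :: "'n::{finite,linorder} rvec"
  shows "step_operator h G \<tau> w U V x \<bullet> y = x \<bullet> step_operator h G \<tau> w U V y"
proof -
  have drift: "((diag z ** diag z) *v x) \<bullet> y = x \<bullet> ((diag z ** diag z) *v y)" for z :: "'n rvec"
    by (simp add: matrix_vector_mul_assoc [symmetric] inner_diag_mult)
  \<comment> \<open>Read as a function of the state \<open>z\<close>, the noise term is a diagonal
    matrix with entries from \<open>G *v w\<close>, hence symmetric like the drift.\<close>
  have "(diag z ** G) *v w = diag (G *v w) *v z" for z
    by (simp add: matrix_vector_mul_assoc [symmetric] diag_mult_commute [of z])
  then have noise: "((diag x ** G) *v w) \<bullet> y = x \<bullet> ((diag y ** G) *v w)"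
    by (simp add: inner_diag_mult)
  show ?thesis
    by (simp add: step_operator_def noise drift inner_diff_left inner_diff_right inner_add_left
        inner_add_right inner_laplacian matrix_vector_mult_add_rdistrib)
qed

lemma flow_a_eq: "flow_a h G \<tau> w (Q, X, P, Y) =
    (Q, X + step_operator h G \<tau> w Q Y Y, P - step_operator h G \<tau> w Q Y Q, Y)"
  by (simp add: flow_a_def step_operator_def)

lemma flow_b_eq: "flow_b h G \<tau> w (Q, X, P, Y) =
    (Q + step_operator h G \<tau> w P X P, X, P, Y - step_operator h G \<tau> w P X X)"
  by (simp add: flow_b_def step_operator_def)

definition ext_charge :: "'n::finite ext_state \<Rightarrow> real" where
  "ext_charge = (\<lambda>(Q, X, P, Y). Q \<bullet> X + P \<bullet> Y)"

lemma ext_charge_flow_a: "ext_charge (flow_a h G \<tau> w Z) = ext_charge Z"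
  by (cases Z) (simp add: ext_charge_def flow_a_eq inner_add_right inner_diff_left
      inner_step_operator)

lemma ext_charge_flow_b: "ext_charge (flow_b h G \<tau> w Z) = ext_charge Z"
  by (cases Z) (simp add: ext_charge_def flow_b_eq inner_add_left inner_diff_right
      inner_step_operator)

lemma ext_charge_Lie: "ext_charge (Lie_splitting h G u Z) = ext_charge Z"
  by (cases u) (simp add: Lie_splitting_def ext_charge_flow_a ext_charge_flow_b)

lemma ext_charge_Strang: "ext_charge (Strang_splitting h G u Z) = ext_charge Z"
  by (cases u) (simp add: Strang_splitting_def ext_charge_flow_a ext_charge_flow_b)

text \<open>The perturbation moves the two copies of each component in opposite directions, which is
  why it changes \<open>ext_charge\<close> on the kernel only at second order.\<close>

lemma adjoint_proj_A:
  "adjoint proj_A = (\<lambda>(l, m). (l, - l, m, - m) :: 'n::finite ext_state)"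
  by (rule adjoint_unique) (auto simp: proj_A_def inner_diff_left)

lemma sym_proj_charge:
  fixes F :: "'u \<Rightarrow> 'n::finite ext_state \<Rightarrow> 'n ext_state"
  assumes charge: "\<And>Z. ext_charge (F u Z) = ext_charge Z"
    and res: "sym_proj F u (Q, Q, P, P) l = (Q', X', P', Y')"
    and ker: "proj_A (sym_proj F u (Q, Q, P, P) l) = 0"
  shows "P' \<bullet> P' + Q' \<bullet> Q' = P \<bullet> P + Q \<bullet> Q"
proof -
  obtain l1 l2 where l: "l = (l1, l2)" by (cases l)
  have [simp]: "X' = Q'" "Y' = P'"
    using ker by (simp_all add: res proj_A_def zero_prod_def)
  \<comment> \<open>The projection equation solved for the output of \<open>F\<close>, using that
    the two copies agree after the step.\<close>
  have "F u (Q + l1, Q - l1, P + l2, P - l2) = (Q' - l1, Q' + l1, P' - l2, P' + l2)"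
    using res by (cases "F u (Q + l1, Q - l1, P + l2, P - l2)")
      (auto simp: sym_proj_def adjoint_proj_A l)
  \<comment> \<open>Expanding the products, \<open>l1 \<bullet> l1 + l2 \<bullet> l2\<close> is
    subtracted from the charge on both sides.\<close>
  with charge [of "(Q + l1, Q - l1, P + l2, P - l2)"] show ?thesis
    by (simp add: ext_charge_def inner_simps inner_commute)
qed

text \<open>The parameter lies in \<open>U\<close> and the value of \<open>g\<close> in
  \<open>V\<close>, so the equivalence defining \<open>g\<close> applies at this very pair.\<close>

lemma proj_multiplier_ker:
  assumes "proj_multiplier F u Z l"
  shows "proj_A (sym_proj F u Z l) = 0"
  using assms unfolding proj_multiplier_def implicit_local_solution_def by blast

lemma full_discretization_charge:
  assumes charge: "\<And>Z. ext_charge (F u Z) = ext_charge Z"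
    and ex: "\<exists>l. proj_multiplier F u (Q, Q, P, P) l"
    and step: "(Q', P', B', \<Theta>') = full_discretization h F u (Q, P, B, \<Theta>)"
  shows "P' \<bullet> P' + Q' \<bullet> Q' = P \<bullet> P + Q \<bullet> Q"
proof -
  define l where "l = (SOME l. proj_multiplier F u (Q, Q, P, P) l)"
  have "proj_A (sym_proj F u (Q, Q, P, P) l) = 0"
    using someI_ex [OF ex] unfolding l_def by (rule proj_multiplier_ker)
  \<comment> \<open>The discretization discards the second copies \<open>X'\<close> and
    \<open>Y'\<close>; they are recovered from the projected state.\<close>
  moreover obtain X' Y' where "sym_proj F u (Q, Q, P, P) l = (Q', X', P', Y')"
    using step by (cases "sym_proj F u (Q, Q, P, P) l")
      (simp add: full_discretization_def Let_def l_def)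
  ultimately show ?thesis
    using sym_proj_charge [of F u] charge by blast
qed

theorem theorem3p4:
  fixes M :: "'w measure"
    and a b h T dt :: real
    and L N n :: nat
    and lam :: "'m::finite \<Rightarrow> real"
    and e :: "'m \<Rightarrow> real \<Rightarrow> real"
    and beta :: "'m \<Rightarrow> real \<Rightarrow> 'w \<Rightarrow> real"
    and G :: "('n::{finite,linorder}, 'm::finite) rmat"
    and F :: "'m step_data \<Rightarrow> 'n ext_state \<Rightarrow> 'n ext_state"
    and Q P B \<Theta> :: "nat \<Rightarrow> 'w \<Rightarrow> 'n rvec"
  assumes "prob_space M"
    and "a < b" and "2 \<le> L" and "CARD('n) = L - 1" and "h = (b - a) / real L"
    and "0 < T" and "1 \<le> N" and "dt = T / real N"
    and "Q_Wiener_expansion M a b lam e beta"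
    and "G = noise_E a h e ** noise_Lambda lam"
    and "F = Lie_splitting h G \<or> F = Strang_splitting h G"
    and "AE \<omega> in M. B 0 \<omega> = D_minus h *v Q 0 \<omega> \<and> \<Theta> 0 \<omega> = D_minus h *v P 0 \<omega>"
    and "\<forall>k<N. AE \<omega> in M.
           (Q (Suc k) \<omega>, P (Suc k) \<omega>, B (Suc k) \<omega>, \<Theta> (Suc k) \<omega>) =
             full_discretization h F (step_data beta dt k \<omega>) (Q k \<omega>, P k \<omega>, B k \<omega>, \<Theta> k \<omega>)"
    and "n < N"
  shows "AE \<omega> in M.
           (\<exists>l. proj_multiplier F (step_data beta dt n \<omega>) (Q n \<omega>, Q n \<omega>, P n \<omega>, P n \<omega>) l) \<longrightarrow>
           P (Suc n) \<omega> \<bullet> P (Suc n) \<omega> + Q (Suc n) \<omega> \<bullet> Q (Suc n) \<omega> = P n \<omega> \<bullet> P n \<omega> + Q n \<omega> \<bullet> Q n \<omega>"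
proof -
  have charge: "ext_charge (F u Z) = ext_charge Z" for u Z
    using assms(11) by (auto simp: ext_charge_Lie ext_charge_Strang)
  have "AE \<omega> in M. (Q (Suc n) \<omega>, P (Suc n) \<omega>, B (Suc n) \<omega>, \<Theta> (Suc n) \<omega>) =
      full_discretization h F (step_data beta dt n \<omega>) (Q n \<omega>, P n \<omega>, B n \<omega>, \<Theta> n \<omega>)"
    using assms(13) \<open>n < N\<close> by blast
  then show ?thesis
    \<comment> \<open>The conservation is pathwise: \<open>charge\<close> holds for all step data,
      so only the recursion is almost sure.\<close>
    by eventually_elim (use full_discretization_charge [of F] charge in blast)
qed

end
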